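(* Let $n\ge 2$ be an integer and let $(X,d)$ be a metric space with $|X|=n$. Let $\rho$ be the ratio between the largest distance and the smallest nonzero distance in $(X,d)$. Then there are at least $0.25\,(n/\rho)^{2/3}$ distinct lines in $(X,d)$.
   Context: For points $a,b,c$ of a metric space $(X,d)$, write $[abc]$ if $a,b,c$ are three distinct points and $d(a,b)+d(b,c)=d(a,c)$. For any two distinct points $u,v\in X$, the line $\overline{uv}$ is the set $\{p:[puv]\}\cup\{u\}\cup\{p:[upv]\}\cup\{v\}\cup\{p:[uvp]\}$. The lines of $(X,d)$ are the sets $\overline{uv}$ with $u,v$ ranging over pairs of distinct points; distinct lines are counted as distinct subsets of $X$. *)

theory Defs
  imports "HOL-Analysis.Analysis"
begin

text \<open>Throughout, \<open>X\<close> is the carrier and \<open>d\<close> the distance function of a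
  \<^locale>\<open>Metric_space\<close>.\<close>

text \<open>\<open>between d a b c\<close> is the relation written \<open>[abc]\<close>.\<close>

definition between :: "('a \<Rightarrow> 'a \<Rightarrow> real) \<Rightarrow> 'a \<Rightarrow> 'a \<Rightarrow> 'a \<Rightarrow> bool" where
  "between d a b c \<longleftrightarrow> a \<noteq> b \<and> b \<noteq> c \<and> a \<noteq> c \<and> d a b + d b c = d a c"

definition metric_line :: "'a set \<Rightarrow> ('a \<Rightarrow> 'a \<Rightarrow> real) \<Rightarrow> 'a \<Rightarrow> 'a \<Rightarrow> 'a set" where
  "metric_line X d u v =
     {p \<in> X. between d p u v} \<union> {u} \<union> {p \<in> X. between d u p v} \<union> {v} \<union> {p \<in> X. between d u v p}"

definition metric_lines :: "'a set \<Rightarrow> ('a \<Rightarrow> 'a \<Rightarrow> real) \<Rightarrow> 'a set set" where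
  "metric_lines X d = {metric_line X d u v | u v. u \<in> X \<and> v \<in> X \<and> u \<noteq> v}"

definition distances :: "'a set \<Rightarrow> ('a \<Rightarrow> 'a \<Rightarrow> real) \<Rightarrow> real set" where
  "distances X d = {d x y | x y. x \<in> X \<and> y \<in> X}"

text \<open>Only meaningful when \<open>X\<close> is finite with at least two points, so that both extrema are
  taken over finite nonempty sets.\<close>

definition distance_ratio :: "'a set \<Rightarrow> ('a \<Rightarrow> 'a \<Rightarrow> real) \<Rightarrow> real" where
  "distance_ratio X d = Max (distances X d) / Min (distances X d - {0})"

end

theory Submission
  imports Defs
begin

text \<open>Fix a point \<open>u\<close> and sort the other points \<open>v\<close> by the line \<open>uv\<close> and by the integer part of
  \<open>d u v / \<delta>\<close>, where \<open>\<delta>\<close> is the smallest nonzero distance. If \<open>v\<close> and \<open>w\<close> land in the same class,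
  then \<open>u, v, w\<close> are collinear and \<open>\<bar>d u v - d u w\<bar> < \<delta>\<close>, which leaves only \<open>[vuw]\<close>. So a class is a
  star with centre \<open>u\<close>; no three of its points are collinear, and a class of \<open>k\<close> points yields
  \<open>k choose 2\<close> lines. With \<open>m\<close> lines there are at most \<open>m \<rho>\<close> classes, each of size at most
  \<open>2 \<surd>m\<close>, hence \<open>n - 1 \<le> 2 \<rho> m powr (3/2)\<close>.\<close>

lemma finite_metric_lines: "finite X \<Longrightarrow> finite (metric_lines X d)"
  by (rule finite_subset[of _ "(\<lambda>(u, v). metric_line X d u v) ` (X \<times> X)"])
    (auto simp: metric_lines_def)

lemma card_le_card_image_mult:
  assumes "finite A" "finite B" "f ` A \<subseteq> B"
    and "\<And>y. y \<in> B \<Longrightarrow> card {x \<in> A. f x = y} \<le> k"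
  shows "card A \<le> card B * k"
proof -
  have "A = (\<Union>y\<in>B. {x \<in> A. f x = y})"
    using assms(3) by auto
  then have "card A \<le> (\<Sum>y\<in>B. card {x \<in> A. f x = y})"
    using card_UN_le[OF assms(2), of "\<lambda>y. {x \<in> A. f x = y}"] by simp
  also have "\<dots> \<le> card B * k"
    using sum_bounded_above[of B "\<lambda>y. card {x \<in> A. f x = y}" k] assms(4) by simp
  finally show ?thesis .
qed

text \<open>For \<open>k \<ge> 2\<close> one has \<open>k \<le> 2 * (k - 1)\<close>, so
  \<open>k * k\<close> is at most four times \<open>k choose 2\<close>. The assumption
  \<open>m \<ge> 1\<close> covers \<open>k = 1\<close>, where the binomial coefficient
  vanishes.\<close>

lemma square_le_of_choose_two_le:
  fixes k m :: nat
  assumes "k choose 2 \<le> m" "m \<ge> 1"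
  shows "k\<^sup>2 \<le> 4 * m"
proof (cases "k \<le> 2")
  case True
  then have "k\<^sup>2 \<le> 2\<^sup>2"
    by (intro power_mono) auto
  then show ?thesis
    using assms(2) by simp
next
  case False
  then obtain j where k: "k = Suc j" and "j \<ge> 1"
    by (cases k) auto
  have "k * (k - 1) = 2 * (k choose 2)"
    unfolding choose_two by (rule dvd_mult_div_cancel[symmetric]) auto
  then have "Suc j * j \<le> 2 * m"
    using assms(1) k by simp
  moreover have "(Suc j)\<^sup>2 \<le> 2 * (Suc j * j)"
    using \<open>j \<ge> 1\<close> by (simp add: power2_eq_square)
  ultimately show ?thesis
    using k by simp
qed

context Metric_space
begin

text \<open>Since \<open>w\<close> lies on the line \<open>uv\<close>, one of the three points is
  between the other two. If it were \<open>v\<close> or \<open>w\<close>, then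
  \<open>\<bar>d u v - d u w\<bar>\<close> would equal \<open>d v w\<close>, so it is
  \<open>u\<close>.\<close>

lemma centre_of_equal_lines:
  assumes "u \<in> M" "v \<in> M" "w \<in> M" "u \<noteq> v" "u \<noteq> w" "v \<noteq> w"
    and eq: "metric_line M d u v = metric_line M d u w"
    and "\<bar>d u v - d u w\<bar> < d v w"
  shows "d v w = d u v + d u w"
proof -
  have "w \<in> metric_line M d u v"
    by (subst eq) (simp add: metric_line_def)
  then have "between d w u v \<or> between d u w v \<or> between d u v w"
    using assms by (auto simp: metric_line_def)
  then show ?thesis
    using assms(8) commute[of w v] commute[of w u] by (auto simp: between_def)
qed

text \<open>Distinct pairs in \<open>S\<close> span distinct lines, because the line through two
  points of \<open>S\<close> meets \<open>S\<close> in these two points only.\<close>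

lemma star_choose_two_le_card_lines:
  assumes "finite M" "u \<in> M" "S \<subseteq> M - {u}"
    and star: "\<And>v w. v \<in> S \<Longrightarrow> w \<in> S \<Longrightarrow> v \<noteq> w \<Longrightarrow> d v w = d u v + d u w"
  shows "card S choose 2 \<le> card (metric_lines M d)"
proof -
  have "finite S"
    using assms(1,3) finite_subset by blast
  have pos: "d u v > 0" if "v \<in> S" for v
    using that assms(2,3) by (intro mdist_pos_less) auto
  \<comment> \<open>Passing through \<open>q\<close> costs the detour \<open>2 * d u q > 0\<close>
    over the direct distance \<open>d p r = d u p + d u r\<close>.\<close>
  have no_between: "\<not> between d p q r" if "p \<in> S" "q \<in> S" "r \<in> S" for p q r
    using that star[of p q] star[of q r] star[of p r] pos[of q] by (auto simp: between_def)
  have "{T. T \<subseteq> S \<and> card T = 2} \<subseteq> (\<lambda>L. L \<inter> S) ` metric_lines M d"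
  proof clarsimp
    fix T assume "T \<subseteq> S" "card T = 2"
    then obtain v w where T: "T = {v, w}" "v \<noteq> w"
      by (auto simp: card_2_iff)
    have "metric_line M d v w \<inter> S = T"
      using T \<open>T \<subseteq> S\<close> no_between by (auto simp: metric_line_def)
    moreover have "metric_line M d v w \<in> metric_lines M d"
      using T \<open>T \<subseteq> S\<close> assms(3) by (auto simp: metric_lines_def)
    ultimately show "T \<in> (\<lambda>L. L \<inter> S) ` metric_lines M d"
      by blast
  qed
  then have "card {T. T \<subseteq> S \<and> card T = 2} \<le> card (metric_lines M d)"
    by (rule surj_card_le[OF finite_metric_lines[OF assms(1)]])
  then show ?thesis
    by (simp add: n_subsets[OF \<open>finite S\<close>])
qed

text \<open>This is the counting argument with any bounds \<open>\<delta>\<close> and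
  \<open>\<Delta>\<close> on the distances. Squaring keeps the exponents integral.\<close>

lemma card_lines_cube_bound:
  assumes "finite M" "card M \<ge> 2" "\<delta> > 0"
    and lower: "\<And>x y. x \<in> M \<Longrightarrow> y \<in> M \<Longrightarrow> x \<noteq> y \<Longrightarrow> \<delta> \<le> d x y"
    and upper: "\<And>x y. x \<in> M \<Longrightarrow> y \<in> M \<Longrightarrow> d x y \<le> \<Delta>"
  shows "(real (card M) / (\<Delta> / \<delta>))\<^sup>2 \<le> 16 * real (card (metric_lines M d)) ^ 3"
proof -
  define m where "m = card (metric_lines M d)"
  obtain u v where uv: "u \<in> M" "v \<in> M" "u \<noteq> v"
    using assms(2) by (metis card_le_Suc0_iff_eq assms(1) not_less_eq_eq numeral_2_eq_2)
  have "metric_line M d u v \<in> metric_lines M d"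
    using uv by (auto simp: metric_lines_def)
  then have m: "m \<ge> 1"
    using finite_metric_lines[OF assms(1)] unfolding m_def
    by (metis One_nat_def Suc_leI card_gt_0_iff empty_iff)
  have "\<delta> \<le> \<Delta>"
    using lower upper uv by fastforce
  then have rho: "\<Delta> / \<delta> \<ge> 1"
    using \<open>\<delta> > 0\<close> by simp
  define f where "f v = (metric_line M d u v, \<lfloor>d u v / \<delta>\<rfloor>)" for v
  \<comment> \<open>The integer parts start at 1 because \<open>d u v \<ge> \<delta>\<close>. Hence
    there are only \<open>\<lfloor>\<Delta> / \<delta>\<rfloor>\<close> of them and the number of
    classes is at most \<open>m * (\<Delta> / \<delta>)\<close>.\<close>
  define B where "B = metric_lines M d \<times> {1..\<lfloor>\<Delta> / \<delta>\<rfloor>}"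
  define k where "k = nat \<lfloor>2 * sqrt (real m)\<rfloor>"
  have "1 \<le> \<lfloor>d u v / \<delta>\<rfloor> \<and> \<lfloor>d u v / \<delta>\<rfloor> \<le> \<lfloor>\<Delta> / \<delta>\<rfloor>" if "v \<in> M - {u}" for v
    using that lower[of u v] upper[of u v] uv(1) \<open>\<delta> > 0\<close>
    by (intro conjI floor_mono divide_right_mono) (auto simp: le_floor_iff)
  then have "f ` (M - {u}) \<subseteq> B"
    using uv(1) by (auto simp: f_def B_def metric_lines_def)
  moreover have "card {v \<in> M - {u}. f v = y} \<le> k" for y
  proof -
    define S where "S = {v \<in> M - {u}. f v = y}"
    have "d v w = d u v + d u w" if "v \<in> S" "w \<in> S" "v \<noteq> w" for v w
    proof (rule centre_of_equal_lines)
      have "\<lfloor>d u v / \<delta>\<rfloor> = \<lfloor>d u w / \<delta>\<rfloor>"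
        using that by (auto simp: S_def f_def)
      then have "\<bar>d u v / \<delta> - d u w / \<delta>\<bar> < 1"
        by linarith
      then have "\<bar>d u v - d u w\<bar> < \<delta>"
        using \<open>\<delta> > 0\<close> by (simp flip: diff_divide_distrib add: abs_divide)
      also have "\<delta> \<le> d v w"
        using that lower by (auto simp: S_def)
      finally show "\<bar>d u v - d u w\<bar> < d v w" .
    qed (use that uv(1) in \<open>auto simp: S_def f_def\<close>)
    then have "card S choose 2 \<le> m"
      unfolding m_def using assms(1) uv(1)
      by (intro star_choose_two_le_card_lines[of u]) (auto simp: S_def)
    then have "real ((card S)\<^sup>2) \<le> real (4 * m)"
      using square_le_of_choose_two_le[OF _ m] by (simp only: of_nat_le_iff)
    then have "real (card S) \<le> 2 * sqrt (real m)"
      using real_le_rsqrt[of "real (card S)" "4 * real m"] by (simp add: real_sqrt_mult)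
    then show ?thesis
      by (simp add: k_def S_def le_nat_floor)
  qed
  ultimately have "card (M - {u}) \<le> card B * k"
    using assms(1) by (intro card_le_card_image_mult) (auto simp: B_def finite_metric_lines)
  then have "real (card (M - {u})) \<le> real (card B) * real k"
    by (metis of_nat_le_iff of_nat_mult)
  also have "\<dots> \<le> (real m * (\<Delta> / \<delta>)) * (2 * sqrt (real m))"
  proof (rule mult_mono)
    have "real (card B) = real m * real_of_int \<lfloor>\<Delta> / \<delta>\<rfloor>"
      using rho by (simp add: B_def m_def card_cartesian_product)
    then show "real (card B) \<le> real m * (\<Delta> / \<delta>)"
      by (simp only: mult_left_mono of_int_floor_le of_nat_0_le_iff)
  qed (use rho in \<open>simp_all add: k_def del: times_divide_eq_right\<close>)
  \<comment> \<open>The leading factor 2 restores the removed point \<open>u\<close>: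
    \<open>n \<le> 2 * (n - 1)\<close> for \<open>n \<ge> 2\<close>.\<close>
  finally have "real (card M) \<le> 2 * ((real m * (\<Delta> / \<delta>)) * (2 * sqrt (real m)))"
    using assms(1,2) uv(1) by simp
  then have "real (card M) / (\<Delta> / \<delta>) \<le> 4 * (real m * sqrt (real m))"
    using rho by (subst pos_divide_le_eq) (simp_all add: mult_ac)
  then have "(real (card M) / (\<Delta> / \<delta>))\<^sup>2 \<le> (4 * (real m * sqrt (real m)))\<^sup>2"
    using \<open>\<delta> > 0\<close> \<open>\<delta> \<le> \<Delta>\<close> by (intro power_mono) auto
  also have "\<dots> = 16 * real m ^ 3"
    by (simp add: power_mult_distrib power2_eq_square power3_eq_cube)
  finally show ?thesis
    by (simp add: m_def)
qed

end

theorem theorem1: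
  fixes X :: "'a set" and d :: "'a \<Rightarrow> 'a \<Rightarrow> real" and n :: nat and \<rho> :: real
  assumes "n \<ge> 2"
    and "Metric_space X d"
    and "finite X" and "card X = n"
    and "\<rho> = distance_ratio X d"
  shows "real (card (metric_lines X d)) \<ge> 0.25 * (real n / \<rho>) powr (2 / 3)"
proof -
  interpret Metric_space X d by fact
  define m where "m = real (card (metric_lines X d))"
  have fin: "finite (distances X d)"
    by (rule finite_subset[of _ "(\<lambda>(x, y). d x y) ` (X \<times> X)"])
      (use \<open>finite X\<close> in \<open>auto simp: distances_def\<close>)
  obtain u v where "u \<in> X" "v \<in> X" "u \<noteq> v"
    using assms(1,3,4)
    by (metis card_le_Suc0_iff_eq not_less_eq_eq numeral_2_eq_2)
  then have "d u v \<in> distances X d - {0}"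
    by (auto simp: distances_def)
  then have "Min (distances X d - {0}) \<in> distances X d - {0}"
    using fin by (intro Min_in) auto
  then have Min_pos: "Min (distances X d - {0}) > 0"
    using nonneg by (force simp: distances_def)
  have "0 < d u v"
    using \<open>u \<in> X\<close> \<open>v \<in> X\<close> \<open>u \<noteq> v\<close> by (rule mdist_pos_less[rotated])
  also have "d u v \<le> Max (distances X d)"
    using fin \<open>d u v \<in> distances X d - {0}\<close> by (intro Max_ge) auto
  finally have rho_pos: "\<rho> > 0"
    using Min_pos by (simp add: assms(5) distance_ratio_def)
  have "(real (card X) / \<rho>)\<^sup>2 \<le> 16 * m ^ 3"
    unfolding assms(5) distance_ratio_def m_def
  proof (intro card_lines_cube_bound)
    show "Min (distances X d - {0}) \<le> d x y" if "x \<in> X" "y \<in> X" "x \<noteq> y" for x y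
      using fin that by (intro Min_le) (auto simp: distances_def)
    show "d x y \<le> Max (distances X d)" if "x \<in> X" "y \<in> X" for x y
      using fin that by (intro Max_ge) (auto simp: distances_def)
  qed (use assms Min_pos in auto)
  \<comment> \<open>Rounding 16 up to 64 gives a perfect cube, whose cube root yields the constant
    0.25.\<close>
  also have "\<dots> \<le> (4 * m) ^ 3"
    by (simp add: power_mult_distrib m_def)
  finally have sq: "(real n / \<rho>)\<^sup>2 \<le> (4 * m) ^ 3"
    using assms(4) by simp
  \<comment> \<open>For \<open>m = 0\<close> the bound would force the positive number
    \<open>(real n / \<rho>)\<^sup>2\<close> to be at most 0.\<close>
  then have "4 * m > 0"
    using rho_pos assms(1) by (cases "m = 0") (auto simp: m_def)
  have "(real n / \<rho>) powr (2 / 3) = ((real n / \<rho>)\<^sup>2) powr (1 / 3)"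
    using rho_pos assms(1) by (simp add: powr_powr flip: powr_numeral)
  also have "\<dots> \<le> ((4 * m) ^ 3) powr (1 / 3)"
    using sq by (intro powr_mono2) auto
  also have "\<dots> = (4 * m) powr (3 * (1 / 3))"
    unfolding powr_powr[symmetric] using \<open>4 * m > 0\<close> by (subst powr_numeral) auto
  also have "\<dots> = 4 * m"
    using \<open>4 * m > 0\<close> by simp
  finally show ?thesis
    by (simp add: m_def)
qed

end
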